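(* Let $\lambda$ be a nonzero real number and $\alpha$ a nonzero complex number. For every integer $n\ge1$, $$\mathcal{E}_{n,\lambda}^{(\alpha)}=\sum_{k=1}^{n}(-\alpha)_{k}\Big(\frac{1}{2}\Big)^{k}B_{n,k}\big((1)_{1,\lambda},(1)_{2,\lambda},\dots,(1)_{n-k+1,\lambda}\big)=\sum_{k=1}^{n}(-\alpha)_{k}\Big(\frac{1}{2}\Big)^{k}S_{2,\lambda}(n,k).$$
   Context: For nonzero real $\lambda$: $(x)_{0,\lambda}=1$, $(x)_{n,\lambda}=x(x-\lambda)\cdots(x-(n-1)\lambda)$; $e_\lambda^x(t)=(1+\lambda t)^{x/\lambda}=\sum_{n\ge0}(x)_{n,\lambda}\frac{t^n}{n!}$, $e_\lambda(t)=e_\lambda^1(t)$. For complex $y$, $(y)_0=1$, $(y)_k=y(y-1)\cdots(y-k+1)$. The degenerate Euler numbers of order $\alpha$ are defined by $\Big(\frac{2}{e_{\lambda}(t)+1}\Big)^{\alpha}=\sum_{n\ge0}\mathcal{E}_{n,\lambda}^{(\alpha)}\frac{t^{n}}{n!}$. The degenerate Stirling numbers of the second kind $S_{2,\lambda}(n,k)$ are defined by $(x)_{n,\lambda}=\sum_{k=0}^{n}S_{2,\lambda}(n,k)(x)_{k}$ (equivalently $\frac{1}{k!}(e_\lambda(t)-1)^k=\sum_{n\ge k}S_{2,\lambda}(n,k)\frac{t^n}{n!}$). The incomplete Bell polynomials are $B_{n,k}(x_{1},\dots,x_{n-k+1})=\sum\frac{n!}{l_{1}!\cdots l_{n-k+1}!}\prod_{i}\big(\frac{x_{i}}{i!}\big)^{l_{i}}$,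 the sum over nonnegative integers $l_1,\dots,l_{n-k+1}$ with $\sum l_i=k$ and $\sum i\,l_i=n$; equivalently $\frac{1}{k!}\big(\sum_{i\ge1}x_i\frac{t^i}{i!}\big)^k=\sum_{n\ge k}B_{n,k}(x_1,\dots,x_{n-k+1})\frac{t^n}{n!}$. *)

theory Defs
  imports "HOL-Complex_Analysis.Laurent_Convergence"
begin

definition falling_fact :: "'a::comm_ring_1 \<Rightarrow> nat \<Rightarrow> 'a" where
  "falling_fact x n = (\<Prod>i<n. x - of_nat i)"

definition deg_falling_fact :: "'a::comm_ring_1 \<Rightarrow> 'a \<Rightarrow> nat \<Rightarrow> 'a" where
  "deg_falling_fact l x n = (\<Prod>i<n. x - of_nat i * l)"

(* The Taylor series of (1 + l t) powr (x / l) at t = 0; see deg_exp_fps_expansion. *)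
definition deg_exp_fps :: "'a::field_char_0 \<Rightarrow> 'a \<Rightarrow> 'a fps" where
  "deg_exp_fps l x = Abs_fps (\<lambda>n. deg_falling_fact l x n / fact n)"

(* The power F ^ a = (1 + (F - 1)) ^ a with arbitrary exponent, by the binomial series.
   Meaningful only for series F with constant coefficient 1. *)
definition fps_gpow :: "'a::field_char_0 fps \<Rightarrow> 'a \<Rightarrow> 'a fps" where
  "fps_gpow F a = fps_compose (fps_binomial a) (F - 1)"

definition deg_euler :: "real \<Rightarrow> complex \<Rightarrow> nat \<Rightarrow> complex" where
  "deg_euler l a n =
     fact n * fps_nth (fps_gpow (2 / (deg_exp_fps (of_real l) 1 + 1)) a) n"

(* For each n, the coefficients are determined by the expansion of the degenerate falling
   factorial in falling factorials; see deg_stirling2_unique_ex. *)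
definition deg_stirling2 :: "real \<Rightarrow> nat \<Rightarrow> nat \<Rightarrow> real" where
  "deg_stirling2 l n =
     (THE c. (\<forall>k>n. c k = 0) \<and>
        (\<forall>x. deg_falling_fact l x n = (\<Sum>k=0..n. c k * falling_fact x k)))"

(* For k > n the truncated subtraction makes the index set {1}, and the sum is empty. *)
definition incomplete_bell :: "nat \<Rightarrow> nat \<Rightarrow> (nat \<Rightarrow> 'a::field_char_0) \<Rightarrow> 'a" where
  "incomplete_bell n k x =
     (\<Sum>l | l \<in> {1..n-k+1} \<rightarrow>\<^sub>E (UNIV :: nat set) \<and>
            (\<Sum>i=1..n-k+1. l i) = k \<and> (\<Sum>i=1..n-k+1. i * l i) = n.
        fact n / (\<Prod>i=1..n-k+1. fact (l i)) * (\<Prod>i=1..n-k+1. (x i / fact i) ^ l i))"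

lemma finite_incomplete_bell_index:
  "finite {l. l \<in> {1..n-k+1} \<rightarrow>\<^sub>E (UNIV :: nat set) \<and>
            (\<Sum>i=1..n-k+1. l i) = k \<and> (\<Sum>i=1..n-k+1. i * l i) = n}"
proof (rule finite_subset)
  show "finite ({1..n-k+1} \<rightarrow>\<^sub>E {..k})"
    by (intro finite_PiE) auto
  show "{l. l \<in> {1..n-k+1} \<rightarrow>\<^sub>E (UNIV :: nat set) \<and>
            (\<Sum>i=1..n-k+1. l i) = k \<and> (\<Sum>i=1..n-k+1. i * l i) = n}
        \<subseteq> {1..n-k+1} \<rightarrow>\<^sub>E {..k}"
  proof
    fix l
    assume "l \<in> {l. l \<in> {1..n-k+1} \<rightarrow>\<^sub>E (UNIV :: nat set) \<and>
              (\<Sum>i=1..n-k+1. l i) = k \<and> (\<Sum>i=1..n-k+1. i * l i) = n}"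
    then have l: "l \<in> {1..n-k+1} \<rightarrow>\<^sub>E UNIV" and s: "(\<Sum>i=1..n-k+1. l i) = k"
      by auto
    have "l i \<le> k" if "i \<in> {1..n-k+1}" for i
      using member_le_sum[of i "{1..n-k+1}" l] that s by simp
    then show "l \<in> {1..n-k+1} \<rightarrow>\<^sub>E {..k}"
      using l by (auto simp: PiE_iff)
  qed
qed

lemma falling_fact_Suc: "falling_fact x (Suc n) = falling_fact x n * (x - of_nat n)"
  by (simp add: falling_fact_def)

lemma deg_stirling2_unique_ex:
  "\<exists>!c :: nat \<Rightarrow> real. (\<forall>k>n. c k = 0) \<and>
     (\<forall>x. deg_falling_fact l x n = (\<Sum>k=0..n. c k * falling_fact x k))"
proof -
  have ex: "\<exists>c :: nat \<Rightarrow> real. (\<forall>k>n. c k = 0) \<and>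
     (\<forall>x. deg_falling_fact l x n = (\<Sum>k=0..n. c k * falling_fact x k))"
  proof (induction n)
    case 0
    show ?case
      by (rule exI[of _ "\<lambda>k. if k = 0 then 1 else 0"])
         (simp add: deg_falling_fact_def falling_fact_def)
  next
    case (Suc n)
    then obtain c where c0: "\<And>k. k > n \<Longrightarrow> c k = 0"
      and c: "\<And>x. deg_falling_fact l x n = (\<Sum>k=0..n. c k * falling_fact x k)"
      by blast
    define d where "d k = (if k = 0 then 0 else c (k - 1)) + (real k - real n * l) * c k" for k
    have "deg_falling_fact l x (Suc n) = (\<Sum>k=0..Suc n. d k * falling_fact x k)" for x
    proof -
      have "(\<Sum>k=0..Suc n. d k * falling_fact x k) =
          (\<Sum>k=0..Suc n. (if k = 0 then 0 else c (k - 1)) * falling_fact x k) +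
          (\<Sum>k=0..Suc n. (real k - real n * l) * c k * falling_fact x k)"
        by (simp only: d_def distrib_right sum.distrib)
      also have "(\<Sum>k=0..Suc n. (if k = 0 then 0 else c (k - 1)) * falling_fact x k) =
          (\<Sum>k=0..n. c k * falling_fact x (Suc k))"
        by (subst sum.atLeast0_atMost_Suc_shift) simp
      also have "(\<Sum>k=0..Suc n. (real k - real n * l) * c k * falling_fact x k) =
          (\<Sum>k=0..n. (real k - real n * l) * c k * falling_fact x k)"
        by (simp add: c0)
      also have "(\<Sum>k=0..n. c k * falling_fact x (Suc k)) + \<dots> =
          (\<Sum>k=0..n. c k * falling_fact x k) * (x - real n * l)"
        unfolding sum_distrib_right sum.distrib [symmetric]
        by (intro sum.cong) (auto simp: falling_fact_Suc algebra_simps)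
      also have "\<dots> = deg_falling_fact l x (Suc n)"
        by (simp add: c [symmetric]) (simp add: deg_falling_fact_def)
      finally show ?thesis by simp
    qed
    moreover have "d k = 0" if "k > Suc n" for k
      using that c0 by (auto simp: d_def)
    ultimately show ?case by blast
  qed
  have uniq: "c = d"
    if c: "\<forall>k>n. c k = 0" "\<forall>x. deg_falling_fact l x n = (\<Sum>k=0..n. c k * falling_fact x k)"
    and d: "\<forall>k>n. d k = 0" "\<forall>x. deg_falling_fact l x n = (\<Sum>k=0..n. d k * falling_fact x k)"
    for c d :: "nat \<Rightarrow> real"
  proof
    fix k
    show "c k = d k"
    proof (induction k rule: less_induct)
      case (less k)
      show ?case
      proof (cases "k \<le> n")
        case False
        then show ?thesis using c d by simp
      next
        case True
        define S where "S c = (\<Sum>j=0..n. c j * falling_fact (real k) j)" for c :: "nat \<Rightarrow> real"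
        have z: "falling_fact (real k) j = 0" if "j > k" for j
          using that by (auto simp: falling_fact_def)
        have nz: "falling_fact (real k) k \<noteq> 0"
          by (auto simp: falling_fact_def)
        have S: "S c = (\<Sum>j<k. c j * falling_fact (real k) j) + c k * falling_fact (real k) k" for c
        proof -
          have "S c = (\<Sum>j\<in>{..k}. c j * falling_fact (real k) j)"
            unfolding S_def using True z by (intro sum.mono_neutral_right) auto
          then show ?thesis by (simp add: lessThan_Suc_atMost [symmetric])
        qed
        have "S c = S d"
          using c(2) d(2) unfolding S_def by metis
        moreover have "(\<Sum>j<k. c j * falling_fact (real k) j) = (\<Sum>j<k. d j * falling_fact (real k) j)"
          using less by (intro sum.cong) auto
        ultimately show ?thesis
          using nz by (simp add: S)
      qed
    qed
  qed
  show ?thesis using ex uniq by blast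
qed

lemma deg_exp_fps_conv_binomial:
  assumes "l \<noteq> 0"
  shows "deg_exp_fps l x = fps_compose (fps_binomial (x / l)) (fps_const l * fps_X)"
proof (rule fps_ext)
  fix n
  have "deg_falling_fact l x n = l ^ n * (\<Prod>i<n. x / l - of_nat i)"
  proof -
    have "l ^ n * (\<Prod>i<n. x / l - of_nat i) = (\<Prod>i<n. l * (x / l - of_nat i))"
      by (simp add: prod.distrib)
    also have "\<dots> = deg_falling_fact l x n"
      unfolding deg_falling_fact_def using assms by (intro prod.cong) (auto simp: right_diff_distrib)
    finally show ?thesis by simp
  qed
  then show "deg_exp_fps l x $ n = fps_compose (fps_binomial (x / l)) (fps_const l * fps_X) $ n"
    by (simp add: deg_exp_fps_def fps_compose_linear gbinomial_prod_rev atLeast0LessThan)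
qed

lemma deg_exp_fps_expansion:
  fixes l x :: complex
  assumes "l \<noteq> 0"
  shows "(\<lambda>t. (1 + l * t) powr (x / l)) has_fps_expansion deg_exp_fps l x"
proof -
  have "((\<lambda>t. (1 + t) powr (x / l)) \<circ> (\<lambda>t. l * t)) has_fps_expansion
          fps_compose (fps_binomial (x / l)) (fps_const l * fps_X)"
    by (intro has_fps_expansion_compose fps_expansion_intros) auto
  then show ?thesis
    using assms by (simp add: deg_exp_fps_conv_binomial o_def)
qed

(* Consistency with the analytic reading of the generating function. *)
lemma deg_euler_fps_expansion:
  fixes l :: real and a :: complex
  assumes "l \<noteq> 0"
  shows "(\<lambda>t. (2 / ((1 + of_real l * t) powr (1 / of_real l) + 1)) powr a)
           has_fps_expansion Abs_fps (\<lambda>n. deg_euler l a n / fact n)"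
proof -
  define E where "E = deg_exp_fps (complex_of_real l) 1"
  have E0: "E $ 0 = 1"
    by (simp add: E_def deg_exp_fps_def deg_falling_fact_def)
  have *: "(\<lambda>t. 2 / ((1 + of_real l * t) powr (1 / of_real l) + 1) - 1) has_fps_expansion (2 / (E + 1) - 1)"
    unfolding E_def using assms E0
    by (intro has_fps_expansion_diff has_fps_expansion_divide' has_fps_expansion_add
        has_fps_expansion_numeral has_fps_expansion_1 deg_exp_fps_expansion) (auto simp: E_def)
  have "((\<lambda>t. (1 + t) powr a) \<circ> (\<lambda>t. 2 / ((1 + of_real l * t) powr (1 / of_real l) + 1) - 1)) has_fps_expansion
      fps_compose (fps_binomial a) (2 / (E + 1) - 1)"
    using E0 by (intro has_fps_expansion_compose * fps_expansion_intros) (auto simp: fps_divide_unit)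
  also have "fps_compose (fps_binomial a) (2 / (E + 1) - 1) = Abs_fps (\<lambda>n. deg_euler l a n / fact n)"
    by (rule fps_ext) (simp add: deg_euler_def fps_gpow_def E_def)
  finally show ?thesis by (simp add: o_def)
qed

end

theory Submission
  imports Defs
begin

text \<open>
  Let \<open>G = e\<^sub>\<lambda>(t) - 1\<close>. Since \<open>((1 + X) ^ b) ^ a = (1 + X) ^ (a b)\<close> for binomial series, we have
  \<open>(2 / (e\<^sub>\<lambda>(t) + 1)) ^ \<alpha> = (1 + G / 2) ^ (-\<alpha>) = \<Sum>k. (-\<alpha>)\<^sub>k (1 / 2) ^ k (G ^ k / k!)\<close>
  and \<open>e\<^sub>\<lambda>\<^sup>x(t) = (1 + G) ^ x = \<Sum>k. (x)\<^sub>k (G ^ k / k!)\<close>. The second identity shows that the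
  coefficients of \<open>G ^ k / k!\<close> are the degenerate Stirling numbers, and the multinomial theorem
  shows that they are the incomplete Bell polynomials evaluated at the coefficients of \<open>G\<close>.
\<close>

section \<open>Multinomial theorem with exponent functions\<close>

lemma prod_fact_dvd_fact_sum:
  "finite A \<Longrightarrow> (\<Prod>i\<in>A. fact (l i)) dvd (fact (\<Sum>i\<in>A. l i) :: nat)"
proof (induction A rule: finite_induct)
  case (insert x A)
  have "fact (l x) * (\<Prod>i\<in>A. fact (l i)) dvd fact (l x) * (fact (\<Sum>i\<in>A. l i) :: nat)"
    using insert by (intro mult_dvd_mono) auto
  also have "\<dots> dvd fact (l x + (\<Sum>i\<in>A. l i))"
    by (rule fact_fact_dvd_fact)
  finally show ?case
    using insert by simp
qed simp

lemma finite_PiE_nat_sum_eq: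
  assumes "finite A"
  shows "finite {l \<in> A \<rightarrow>\<^sub>E (UNIV :: nat set). (\<Sum>i\<in>A. l i) = k}"
proof (rule finite_subset)
  show "finite (A \<rightarrow>\<^sub>E {..k})"
    using assms by (intro finite_PiE) auto
  show "{l \<in> A \<rightarrow>\<^sub>E (UNIV :: nat set). (\<Sum>i\<in>A. l i) = k} \<subseteq> A \<rightarrow>\<^sub>E {..k}"
    using assms by (auto simp: PiE_iff extensional_def intro: member_le_sum)
qed

text \<open>Induction on \<open>A\<close>: the binomial theorem splits off the exponent
  \<open>j\<close> of the new element \<open>x\<close>, and the pair (j, l) is merged into
  \<open>l(x := j)\<close>. The coefficients are natural-number quotients so that the identity holds
  in every commutative semiring; the divisions are exact by
  \<open>prod_fact_dvd_fact_sum\<close>.\<close>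

lemma multinomial_theorem:
  fixes f :: "'b \<Rightarrow> 'a::comm_semiring_1"
  assumes "finite A"
  shows "(\<Sum>i\<in>A. f i) ^ k =
    (\<Sum>l | l \<in> A \<rightarrow>\<^sub>E (UNIV :: nat set) \<and> (\<Sum>i\<in>A. l i) = k.
       of_nat (fact k div (\<Prod>i\<in>A. fact (l i))) * (\<Prod>i\<in>A. f i ^ l i))"
  using assms
proof (induction A arbitrary: k rule: finite_induct)
  case empty
  show ?case
    by (cases k) simp_all
next
  case (insert x A)
  define L where "L A k = {l \<in> A \<rightarrow>\<^sub>E (UNIV :: nat set). (\<Sum>i\<in>A. l i) = k}" for A :: "'b set" and k
  define summand where "summand A k l =
    of_nat (fact k div (\<Prod>i\<in>A. fact (l i))) * (\<Prod>i\<in>A. f i ^ l i)" for A k and l :: "'b \<Rightarrow> nat"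
  have upd: "(\<Sum>i\<in>A. if i = x then j else l i) = (\<Sum>i\<in>A. l i)" for l :: "'b \<Rightarrow> nat" and j
    using insert.hyps by (intro sum.cong) auto
  have step: "of_nat (k choose j) * f x ^ j * summand A (k - j) l = summand (insert x A) k (l(x := j))"
    if "j \<le> k" "l \<in> L A (k - j)" for j l
  proof -
    \<comment> \<open>The multinomial coefficient for \<open>insert x A\<close> is k choose j times
      the one for \<open>A\<close> with total k - j; the exact quotient \<open>q\<close> allows this
      to be shown without leaving the naturals.\<close>
    define P where "P = (\<Prod>i\<in>A. fact (l i) :: nat)"
    have "P dvd fact (k - j)"
      using prod_fact_dvd_fact_sum[OF insert.hyps(1), of l] that by (simp add: P_def L_def)
    then obtain q where q: "fact (k - j) = P * q" ..
    have P: "P > 0"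
      by (simp add: P_def prod_pos)
    have "(fact k :: nat) = (fact j * P) * ((k choose j) * q)"
      using binomial_fact_lemma[OF that(1)] by (simp add: q ac_simps)
    then have "fact k div (fact j * P) = (k choose j) * (fact (k - j) div P)"
      using P by (simp add: q)
    moreover have "(\<Prod>i\<in>A. fact ((l(x := j)) i)) = P" "(\<Prod>i\<in>A. f i ^ (l(x := j)) i) = (\<Prod>i\<in>A. f i ^ l i)"
      unfolding P_def using insert.hyps by (auto intro!: prod.cong)
    ultimately show ?thesis
      using insert.hyps unfolding summand_def P_def [symmetric] by (simp add: ac_simps)
  qed
  have "(\<Sum>i\<in>insert x A. f i) ^ k =
      (\<Sum>j\<le>k. of_nat (k choose j) * f x ^ j * (\<Sum>i\<in>A. f i) ^ (k - j))"
    using insert.hyps by (simp add: binomial_ring)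
  also have "\<dots> = (\<Sum>j\<le>k. \<Sum>l\<in>L A (k - j). summand (insert x A) k (l(x := j)))"
    by (simp add: insert.IH L_def [symmetric] summand_def [symmetric] sum_distrib_left step)
  also have "\<dots> = (\<Sum>(j, l)\<in>(SIGMA j:{..k}. L A (k - j)). summand (insert x A) k (l(x := j)))"
    using insert.hyps by (intro sum.Sigma) (auto simp: L_def finite_PiE_nat_sum_eq)
  \<comment> \<open>The inverse map resets the value at \<open>x\<close> to
    \<open>undefined\<close>, since members of \<open>L A\<close> are extensional on
    \<open>A\<close>.\<close>
  also have "\<dots> = (\<Sum>l\<in>L (insert x A) k. summand (insert x A) k l)"
    using insert.hyps
    by (intro sum.reindex_bij_witness[of _ "\<lambda>l. (l x, l(x := undefined))" "\<lambda>(j, l). l(x := j)"])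
       (auto simp: L_def upd PiE_iff extensional_def fun_eq_iff)
  finally show ?case
    by (simp add: L_def summand_def)
qed

section \<open>Incomplete Bell polynomials as coefficients of powers\<close>

lemma power_dvd_power_diff:
  fixes a b :: "'a::comm_ring_1"
  shows "a - b dvd a ^ n - b ^ n"
  by (simp add: power_diff_sumr2)

lemma fps_nth_eq_if_X_power_dvd_diff:
  fixes F G :: "'a::field fps"
  assumes "fps_X ^ Suc n dvd F - G"
  shows "F $ n = G $ n"
proof -
  obtain H where "F - G = fps_X ^ Suc n * H"
    using assms ..
  then have "(F - G) $ n = 0"
    by (simp only: fps_X_power_mult_nth) simp
  then show ?thesis
    by simp
qed

text \<open>Writing F = X F' gives F^k = X^k F'^k, so the coefficient at n only sees F' up to degree
  n - k, that is F up to degree n - k + 1. This is where the number of arguments of the Bell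
  polynomial comes from.\<close>

lemma fps_power_nth_truncate:
  fixes F :: "'a::field fps"
  assumes "F $ 0 = 0" "1 \<le> k" "k \<le> n"
  shows "F ^ k $ n = (\<Sum>i=1..n-k+1. fps_const (F $ i) * fps_X ^ i) ^ k $ n"
proof -
  define T where "T = (\<Sum>i=1..n-k+1. fps_const (F $ i) * fps_X ^ i)"
  have T_nth: "T $ j = (if j \<in> {1..n-k+1} then F $ j else 0)" for j
  proof -
    have "T $ j = (\<Sum>i\<in>{1..n-k+1}. if j = i then F $ i else 0)"
      unfolding T_def fps_sum_nth by (intro sum.cong) auto
    then show ?thesis
      by (simp only: sum.delta' finite_atLeastAtMost)
  qed
  define F' T' where "F' = fps_shift 1 F" and "T' = fps_shift 1 T"
  have F: "F = fps_X * F'"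
    by (rule fps_ext) (use assms in \<open>auto simp: F'_def\<close>)
  have T: "T = fps_X * T'"
    by (rule fps_ext) (auto simp: T'_def T_nth)
  have "F' - T' = fps_X ^ (n - k + 1) * fps_shift (n - k + 1) (F' - T')"
    by (rule fps_ext, simp only: fps_X_power_mult_nth) (auto simp: F'_def T'_def T_nth)
  then have "fps_X ^ (n - k + 1) dvd F' ^ k - T' ^ k"
    by (metis dvd_triv_left dvd_trans power_dvd_power_diff)
  \<comment> \<open>The factor X^k lifts the congruence modulo X^(n-k+1) to one modulo X^(n+1),
    which covers the coefficient at n.\<close>
  then have "fps_X ^ k * fps_X ^ (n - k + 1) dvd fps_X ^ k * (F' ^ k - T' ^ k)"
    by (intro mult_dvd_mono) auto
  also have "fps_X ^ k * fps_X ^ (n - k + 1) = (fps_X ^ Suc n :: 'a fps)"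
    using assms by (simp flip: power_add)
  also have "fps_X ^ k * (F' ^ k - T' ^ k) = F ^ k - T ^ k"
    by (simp add: F T power_mult_distrib right_diff_distrib)
  finally show ?thesis
    unfolding T_def by (rule fps_nth_eq_if_X_power_dvd_diff)
qed

lemma of_nat_fact_div_prod_fact:
  assumes "finite A" "(\<Sum>i\<in>A. l i) = k"
  shows "(of_nat (fact k div (\<Prod>i\<in>A. fact (l i))) :: 'a::field_char_0) =
           fact k / (\<Prod>i\<in>A. fact (l i))"
proof -
  obtain q where q: "(fact k :: nat) = (\<Prod>i\<in>A. fact (l i)) * q"
    using prod_fact_dvd_fact_sum[of A l] assms by (auto elim: dvdE)
  have "(\<Prod>i\<in>A. fact (l i) :: nat) > 0"
    by (simp add: prod_pos)
  moreover have "(fact k :: 'a) = (\<Prod>i\<in>A. fact (l i)) * of_nat q"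
    using arg_cong[OF q, of "of_nat :: nat \<Rightarrow> 'a"] by simp
  ultimately show ?thesis
    using assms by (simp add: q)
qed

text \<open>Expanding the truncated power by the multinomial theorem gives one monomial per
  \<open>l\<close>, of degree \<Sum> i * l i; extracting the coefficient at n imposes the second
  constraint on \<open>l\<close>. The factor \<open>fact i\<close> in the argument cancels the one
  in \<open>incomplete_bell\<close>.\<close>

lemma incomplete_bell_conv_fps_power:
  fixes F :: "'a::field_char_0 fps"
  assumes "F $ 0 = 0" "1 \<le> k" "k \<le> n"
  shows "incomplete_bell n k (\<lambda>i. fact i * F $ i) = fact n * (F ^ k $ n) / fact k"
proof -
  define A where "A = {1..n-k+1}"
  define L where "L = {l \<in> A \<rightarrow>\<^sub>E (UNIV :: nat set). (\<Sum>i\<in>A. l i) = k}"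
  have [simp]: "finite A"
    by (simp add: A_def)
  have [simp]: "finite L"
    by (simp add: L_def finite_PiE_nat_sum_eq)
  have monom: "(\<Prod>i\<in>A. (fps_const (F $ i) * fps_X ^ i) ^ l i) =
      fps_const (\<Prod>i\<in>A. (F $ i) ^ l i) * fps_X ^ (\<Sum>i\<in>A. i * l i)" for l
  proof -
    have "(\<Prod>i\<in>A. fps_const (F $ i) ^ l i) = fps_const (\<Prod>i\<in>A. (F $ i) ^ l i)"
      using \<open>finite A\<close> by (induction A rule: finite_induct) (auto simp: fps_const_power)
    then show ?thesis
      by (simp add: power_mult_distrib prod.distrib power_sum power_mult)
  qed
  have "F ^ k $ n = (\<Sum>i\<in>A. fps_const (F $ i) * fps_X ^ i) ^ k $ n"
    unfolding A_def using assms by (rule fps_power_nth_truncate)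
  also have "\<dots> = (\<Sum>l\<in>L. of_nat (fact k div (\<Prod>i\<in>A. fact (l i))) *
      (if (\<Sum>i\<in>A. i * l i) = n then \<Prod>i\<in>A. (F $ i) ^ l i else 0))"
    by (simp add: multinomial_theorem L_def [symmetric] monom fps_sum_nth fps_of_nat [symmetric]
             mult.assoc [symmetric] del: fps_of_nat)
       (auto intro!: sum.cong)
  also have "\<dots> = (\<Sum>l\<in>L. if (\<Sum>i\<in>A. i * l i) = n
      then fact k / (\<Prod>i\<in>A. fact (l i)) * (\<Prod>i\<in>A. (F $ i) ^ l i) else 0)"
    by (intro sum.cong) (auto simp: L_def of_nat_fact_div_prod_fact)
  also have "\<dots> = (\<Sum>l | l \<in> L \<and> (\<Sum>i\<in>A. i * l i) = n.
      fact k / (\<Prod>i\<in>A. fact (l i)) * (\<Prod>i\<in>A. (F $ i) ^ l i))"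
    by (intro sum.inter_filter [symmetric]) simp
  finally show ?thesis
    unfolding incomplete_bell_def A_def [symmetric]
    by (simp add: L_def sum_distrib_left sum_divide_distrib conj_assoc)
qed

section \<open>Transfer to the complex numbers and composition of binomial series\<close>

lemma incomplete_bell_of_real:
  "incomplete_bell n k (\<lambda>i. of_real (x i)) =
     (of_real (incomplete_bell n k x) :: 'a::{real_field, field_char_0})"
  by (simp add: incomplete_bell_def)

lemma deg_falling_fact_of_real:
  "deg_falling_fact (of_real l) (of_real x) n =
     (of_real (deg_falling_fact l x n) :: 'a::{comm_ring_1, real_algebra_1})"
  by (simp add: deg_falling_fact_def)

lemma gbinomial_conv_falling_fact: "a gchoose k = falling_fact a k / fact k"
  by (simp add: falling_fact_def gbinomial_prod_rev atLeast0LessThan)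

text \<open>By the chain rule the composition F satisfies (1 + X) F' = a b F, whose solutions are
  the constant multiples of \<open>fps_binomial (a * b)\<close>; the constant coefficient is
  1.\<close>

lemma fps_binomial_compose_binomial:
  "fps_binomial a oo (fps_binomial b - 1) = fps_binomial (a * b :: 'a::field_char_0)"
proof -
  define B where "B = fps_binomial b"
  define F where "F = fps_binomial a oo (B - 1)"
  have B0: "B $ 0 = 1"
    by (simp add: B_def)
  have deriv: "fps_deriv (fps_binomial c) = fps_const c * fps_binomial c / (1 + fps_X)" for c :: 'a
    using fps_binomial_ODE_unique[of "fps_binomial c" c] by simp
  have "fps_deriv F = (fps_deriv (fps_binomial a) oo (B - 1)) * fps_deriv (B - 1)"
    unfolding F_def using B0 by (intro fps_compose_deriv) simp
  also have "fps_deriv (fps_binomial a) oo (B - 1) = fps_const a * F / B"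
    using B0 by (simp add: deriv F_def fps_divide_compose fps_compose_mult_distrib
        fps_compose_add_distrib)
  also have "fps_deriv (B - 1) = fps_const b * B / (1 + fps_X)"
    by (simp add: B_def deriv)
  also have "fps_const a * F / B * (fps_const b * B / (1 + fps_X)) =
      fps_const (a * b) * F / (1 + fps_X)"
  proof -
    have "inverse B * B = 1"
      using B0 by (simp add: inverse_mult_eq_1)
    then show ?thesis
      using B0 by (simp add: fps_divide_unit fps_const_mult [symmetric] ac_simps del: fps_const_mult)
  qed
  finally have "F = fps_const (F $ 0) * fps_binomial (a * b)"
    by (simp add: fps_binomial_ODE_unique)
  then show ?thesis
    by (simp add: F_def B_def)
qed

section \<open>Degenerate exponential and degenerate Stirling numbers\<close>

lemma deg_exp_fps_nth_0 [simp]: "deg_exp_fps l x $ 0 = 1"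
  by (simp add: deg_exp_fps_def deg_falling_fact_def)

text \<open>This is the composition law with exponents x and 1 / l, after substituting l X for
  X.\<close>

lemma deg_exp_fps_conv_compose:
  assumes "l \<noteq> 0"
  shows "deg_exp_fps l x = fps_binomial x oo (deg_exp_fps l 1 - 1)"
proof -
  have "deg_exp_fps l 1 - 1 = (fps_binomial (1 / l) - 1) oo (fps_const l * fps_X)"
    using assms by (simp add: deg_exp_fps_conv_binomial fps_compose_sub_distrib)
  then have "fps_binomial x oo (deg_exp_fps l 1 - 1) =
      (fps_binomial x oo (fps_binomial (1 / l) - 1)) oo (fps_const l * fps_X)"
    by (simp add: fps_compose_assoc)
  then show ?thesis
    using assms by (simp add: fps_binomial_compose_binomial deg_exp_fps_conv_binomial)
qed

text \<open>The coefficients on the right satisfy the defining property, so uniqueness applies: they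
  vanish for k > n because G^k is divisible by X^k, and the expansion is the coefficient at n of (1
  + G)^x.\<close>

lemma deg_stirling2_conv_fps_power:
  assumes "l \<noteq> 0"
  shows "deg_stirling2 l n k = fact n * ((deg_exp_fps l 1 - 1) ^ k $ n) / fact k"
proof -
  let ?G = "deg_exp_fps l 1 - 1"
  define c where "c k = fact n * (?G ^ k $ n) / fact k" for k
  have "deg_stirling2 l n = c"
    unfolding deg_stirling2_def
  proof (rule the1_equality[OF deg_stirling2_unique_ex], intro conjI allI impI)
    show "c k = 0" if "n < k" for k
      using that startsby_zero_power_prefix[of ?G k] by (simp add: c_def)
    show "deg_falling_fact l x n = (\<Sum>k=0..n. c k * falling_fact x k)" for x
    proof -
      have "deg_falling_fact l x n = fact n * deg_exp_fps l x $ n"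
        by (simp add: deg_exp_fps_def)
      also have "\<dots> = (\<Sum>k=0..n. c k * falling_fact x k)"
        by (subst deg_exp_fps_conv_compose[OF assms])
           (simp add: fps_compose_nth gbinomial_conv_falling_fact sum_distrib_left c_def ac_simps)
      finally show ?thesis .
    qed
  qed
  then show ?thesis
    by (simp add: c_def)
qed

section \<open>Degenerate Euler numbers and comparison of coefficients\<close>

text \<open>With H = (F - 1) / 2 the base is (1 + H)^(-1), so the composition law with inner
  exponent -1 turns the power \<open>a\<close> into (1 + H)^(-a).\<close>

lemma fps_gpow_two_divide:
  fixes F :: "'a::field_char_0 fps"
  assumes "F $ 0 = 1"
  shows "fps_gpow (2 / (F + 1)) a = fps_binomial (- a) oo (fps_const (1 / 2) * (F - 1))"
proof -
  let ?H = "fps_const (1 / 2) * (F - 1)"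
  have two: "(2 :: 'a fps) * fps_const (1 / 2) = 1"
    by (simp add: numeral_fps_const)
  have "F + 1 = 2 * (1 + ?H)"
    by (simp only: distrib_left mult.assoc [symmetric] two) simp
  then have "2 / (F + 1) = inverse (1 + ?H)"
    using assms by (simp add: fps_divide_unit fps_inverse_mult numeral_fps_const fps_const_inverse
        mult.assoc [symmetric])
  also have "\<dots> = inverse (1 + fps_X) oo ?H"
    using assms by (simp add: fps_inverse_compose fps_compose_add_distrib)
  also have "inverse (1 + fps_X) = fps_binomial (- 1 :: 'a)"
    by (simp add: fps_binomial_minus_one)
  finally have "2 / (F + 1) - 1 = (fps_binomial (- 1) - 1) oo ?H"
    by (simp add: fps_compose_sub_distrib)
  then have "fps_gpow (2 / (F + 1)) a = fps_binomial a oo (fps_binomial (- 1) - 1) oo ?H"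
    using assms by (simp add: fps_gpow_def fps_compose_assoc)
  then show ?thesis
    by (simp add: fps_binomial_compose_binomial)
qed

lemma deg_euler_conv_fps_power:
  "deg_euler l a n = (\<Sum>k=0..n. falling_fact (- a) k * (1 / 2) ^ k *
     (fact n * ((deg_exp_fps (of_real l) 1 - 1) ^ k $ n) / fact k))"
  unfolding deg_euler_def fps_gpow_two_divide[OF deg_exp_fps_nth_0]
  by (simp add: fps_compose_nth gbinomial_conv_falling_fact power_mult_distrib fps_const_power
        sum_distrib_left ac_simps)

lemma incomplete_bell_deg_falling_fact:
  assumes "1 \<le> k" "k \<le> n"
  shows "incomplete_bell n k (\<lambda>i. deg_falling_fact l 1 i) =
           fact n * ((deg_exp_fps l 1 - 1) ^ k $ n) / fact k"
proof -
  \<comment> \<open>The Bell polynomial reads its arguments only at indices i \<ge> 1, where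
    subtracting 1 from the series changes nothing.\<close>
  have "incomplete_bell n k (\<lambda>i. deg_falling_fact l 1 i) =
      incomplete_bell n k (\<lambda>i. fact i * (deg_exp_fps l 1 - 1) $ i)"
    unfolding incomplete_bell_def by (intro sum.cong prod.cong arg_cong2[of _ _ _ _ "(*)"] refl)
      (auto simp: deg_exp_fps_def)
  also have "\<dots> = fact n * ((deg_exp_fps l 1 - 1) ^ k $ n) / fact k"
    using assms by (intro incomplete_bell_conv_fps_power) auto
  finally show ?thesis .
qed

theorem theorem6:
  fixes lam :: real and \<alpha> :: complex and n :: nat
  assumes "lam \<noteq> 0" and "\<alpha> \<noteq> 0" and "n \<ge> 1"
  shows "deg_euler lam \<alpha> n =
           (\<Sum>k=1..n. falling_fact (- \<alpha>) k * (1 / 2) ^ k *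
              complex_of_real (incomplete_bell n k (\<lambda>i. deg_falling_fact lam 1 i)))
         \<and> (\<Sum>k=1..n. falling_fact (- \<alpha>) k * (1 / 2) ^ k *
              complex_of_real (incomplete_bell n k (\<lambda>i. deg_falling_fact lam 1 i))) =
           (\<Sum>k=1..n. falling_fact (- \<alpha>) k * (1 / 2) ^ k *
              complex_of_real (deg_stirling2 lam n k))"
proof
  have bell: "complex_of_real (incomplete_bell n k (\<lambda>i. deg_falling_fact lam 1 i)) =
      fact n * ((deg_exp_fps (of_real lam) 1 - 1) ^ k $ n) / fact k" if "k \<in> {1..n}" for k
  proof -
    have "(\<lambda>i. complex_of_real (deg_falling_fact lam 1 i)) = deg_falling_fact (of_real lam) 1"
      using deg_falling_fact_of_real[of lam 1, where 'a = complex] by (simp add: fun_eq_iff)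
    then show ?thesis
      using that incomplete_bell_deg_falling_fact[of k n "complex_of_real lam"]
      by (simp only: atLeastAtMost_iff flip: incomplete_bell_of_real)
  qed
  \<comment> \<open>The term k = 0 drops out: the zeroth power is the series 1, whose coefficient at
    n \<ge> 1 is 0.\<close>
  have "deg_euler lam \<alpha> n = (\<Sum>k=1..n. falling_fact (- \<alpha>) k * (1 / 2) ^ k *
     (fact n * ((deg_exp_fps (of_real lam) 1 - 1) ^ k $ n) / fact k))"
    using assms by (simp add: deg_euler_conv_fps_power sum.atLeast_Suc_atMost)
  then show "deg_euler lam \<alpha> n = (\<Sum>k=1..n. falling_fact (- \<alpha>) k * (1 / 2) ^ k *
      complex_of_real (incomplete_bell n k (\<lambda>i. deg_falling_fact lam 1 i)))"
    by (simp add: bell)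
  \<comment> \<open>Termwise, both real numbers equal the same coefficient, now of the series over
    the reals.\<close>
  show "(\<Sum>k=1..n. falling_fact (- \<alpha>) k * (1 / 2) ^ k *
      complex_of_real (incomplete_bell n k (\<lambda>i. deg_falling_fact lam 1 i))) =
    (\<Sum>k=1..n. falling_fact (- \<alpha>) k * (1 / 2) ^ k * complex_of_real (deg_stirling2 lam n k))"
    using assms by (intro sum.cong)
      (auto simp: incomplete_bell_deg_falling_fact deg_stirling2_conv_fps_power)
qed

end
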